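(* Let $\gamma$ be a smooth closed plane curve without affine inflexions, parametrized by affine arclength $s$, with affine curvature $\mu$. Assume $\mu\neq 0$ and $\alpha\in(0,1)$, and let $$X(s)=\gamma(s)+\frac{\alpha}{(1-\alpha)^2+\mu(s)\alpha^2}\left((1-\alpha)\gamma_s(s)+\alpha\gamma_{ss}(s)\right).$$ Let $s_0$ be a parameter at which $X$ has an affine cusp, i.e. at which $X$ is not regular, equivalently $\mu_s(s_0)=\dfrac{(1-\alpha)\left((1-\alpha)^2+\mu(s_0)\alpha^2\right)}{\alpha^3}$. Then this affine cusp is an ordinary affine cusp if and only if $$\alpha\,\mu_{ss}(s_0)\neq(1-\alpha)\,\mu_s(s_0).$$
   Context: For $u,v\in\mathbb{R}^2$, $[u,v]$ denotes the determinant with columns $u,v$; subscripts denote derivatives. A curve is parametrized by affine arclength $s$ if $[\gamma_s,\gamma_{ss}]=1$ for all $s$; then $\gamma_{sss}=-\mu\gamma_s$, where $\mu=[\gamma_{ss},\gamma_{sss}]$ is the affine curvature. "Closed" means that $\gamma$ is a smooth periodic function of $s$. An affine inflexion is a point where $\mu=0$. Under these assumptions $(1-\alpha)^2+\mu(s)\alpha^2\neq 0$ for all $s$. The curve $X$ is the envelope of the lines through $\gamma(s)$ with direction $(1-\alpha)\gamma_s+\alpha\gamma_{ss}$. A non-regular point $s_0$ of $X$ ($X_s(s_0)=0$) is an ordinary affine cusp if the vectors $X_{ss}(s_0)$ and $X_{sss}(s_0)$ are linearly independent. *)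

theory Defs
  imports "HOL-Analysis.Analysis"
begin

definition bracket :: "real^2 \<Rightarrow> real^2 \<Rightarrow> real"
  where "bracket u v = det (transpose (vector [u, v] :: real^2^2))"
  \<comment> \<open>\<open>vector [u, v]\<close> has rows \<open>u\<close>, \<open>v\<close>; the transpose has them as columns\<close>

definition vd :: "(real \<Rightarrow> 'a::real_normed_vector) \<Rightarrow> real \<Rightarrow> 'a"
  where "vd f s = vector_derivative f (at s)"

definition smooth :: "(real \<Rightarrow> 'a::real_normed_vector) \<Rightarrow> bool"
  where "smooth f \<longleftrightarrow> (\<forall>k s. (vd ^^ k) f differentiable (at s))"

definition closed_curve :: "(real \<Rightarrow> real^2) \<Rightarrow> bool"
  where "closed_curve \<gamma> \<longleftrightarrow> smooth \<gamma> \<and> (\<exists>L>0. \<forall>s. \<gamma> (s + L) = \<gamma> s)"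

definition affine_arclength_param :: "(real \<Rightarrow> real^2) \<Rightarrow> bool"
  where "affine_arclength_param \<gamma> \<longleftrightarrow> (\<forall>s. bracket (vd \<gamma> s) (vd (vd \<gamma>) s) = 1)"

definition affine_curvature :: "(real \<Rightarrow> real^2) \<Rightarrow> real \<Rightarrow> real"
  where "affine_curvature \<gamma> s = bracket (vd (vd \<gamma>) s) (vd (vd (vd \<gamma>)) s)"

definition affine_inflexion :: "(real \<Rightarrow> real^2) \<Rightarrow> real \<Rightarrow> bool"
  where "affine_inflexion \<gamma> s \<longleftrightarrow> affine_curvature \<gamma> s = 0"

text \<open>
  The next two notions are meant for smooth \<open>X\<close>: \<open>vector_derivative\<close> takes an unspecified
  value where the derivative does not exist.
\<close>

definition affine_cusp :: "(real \<Rightarrow> real^2) \<Rightarrow> real \<Rightarrow> bool"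
  where "affine_cusp X s \<longleftrightarrow> vd X s = 0"

text \<open>
  The disequality is needed because \<open>independent\<close> is a predicate on sets:
  \<open>{v, v}\<close> is independent whenever \<open>v \<noteq> 0\<close>.
\<close>

definition ordinary_affine_cusp :: "(real \<Rightarrow> real^2) \<Rightarrow> real \<Rightarrow> bool"
  where "ordinary_affine_cusp X s \<longleftrightarrow>
    affine_cusp X s \<and>
    vd (vd X) s \<noteq> vd (vd (vd X)) s \<and>
    independent {vd (vd X) s, vd (vd (vd X)) s}"

end

theory Submission
  imports Defs
begin

text \<open>
  Write \<open>\<beta> = 1 - \<alpha>\<close>, \<open>T = \<gamma>\<^sub>s\<close>, \<open>N = \<gamma>\<^sub>s\<^sub>s\<close>, \<open>D = \<beta>\<^sup>2 + \<mu> \<alpha>\<^sup>2\<close> and let \<open>W = \<beta> T + \<alpha> N\<close> be the direction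
  of the moving line. Since \<open>X\<close> envelops these lines, its velocity is a multiple of \<open>W\<close>: from
  \<open>N\<^sub>s = - \<mu> T\<close> one obtains \<open>D T + \<alpha> W\<^sub>s = \<beta> W\<close>, hence \<open>X\<^sub>s = h W\<close> with
  \<open>h = (\<beta> D - \<alpha>\<^sup>3 \<mu>\<^sub>s) / D\<^sup>2\<close>. As \<open>W \<noteq> 0\<close>, the cusps are the zeros of \<open>h\<close>, which is the first
  equivalence. At a zero of \<open>h\<close>, \<open>X\<^sub>s\<^sub>s = h\<^sub>s W\<close> and \<open>X\<^sub>s\<^sub>s\<^sub>s = h\<^sub>s\<^sub>s W + 2 h\<^sub>s W\<^sub>s\<close>, so
  \<open>[X\<^sub>s\<^sub>s, X\<^sub>s\<^sub>s\<^sub>s] = 2 h\<^sub>s\<^sup>2 [W, W\<^sub>s] = 2 h\<^sub>s\<^sup>2 D\<close> and the cusp is ordinary precisely when \<open>h\<^sub>s \<noteq> 0\<close>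
  (\<open>vanishing_velocity_cusp\<close>). There \<open>h\<^sub>s\<close> is \<open>\<alpha>\<^sup>2 (\<beta> \<mu>\<^sub>s - \<alpha> \<mu>\<^sub>s\<^sub>s) / D\<^sup>2\<close>, which is the second
  equivalence.

  All of this needs \<open>D \<noteq> 0\<close>, and here closedness enters: a closed curve without affine inflexions
  has \<open>\<mu> > 0\<close> (\<open>closed_curve_affine_curvature_pos\<close>), whence \<open>D > 0\<close>.
\<close>

section \<open>The determinant of two plane vectors\<close>

lemma bracket_components: "bracket u v = u$1 * v$2 - u$2 * v$1"
  by (simp add: bracket_def det_2 transpose_def vector_2)

lemma bracket_self [simp]: "bracket u u = 0"
  by (simp add: bracket_components)

lemma bracket_swap: "bracket v u = - bracket u v"
  by (simp add: bracket_components)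

lemma bounded_bilinear_bracket: "bounded_bilinear bracket"
proof (rule bounded_bilinear.intro)
  show "\<exists>K. \<forall>u v. norm (bracket u v) \<le> norm u * norm v * K"
  proof (intro exI[of _ 2] allI)
    fix u v :: "real^2"
    have "\<bar>u$1 * v$2\<bar> \<le> norm u * norm v" "\<bar>u$2 * v$1\<bar> \<le> norm u * norm v"
      unfolding abs_mult by (intro mult_mono component_le_norm_cart; simp)+
    then show "norm (bracket u v) \<le> norm u * norm v * 2"
      unfolding bracket_components real_norm_def by linarith
  qed
qed (simp_all add: bracket_components algebra_simps)

interpretation bracket: bounded_bilinear bracket
  by (rule bounded_bilinear_bracket)

text \<open>
  Cramer's rule; it turns the vanishing of \<open>[\<gamma>\<^sub>s, \<gamma>\<^sub>s\<^sub>s\<^sub>s]\<close> into the structure equation of the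
  affine frame.
\<close>

lemma expand_in_unimodular_frame:
  assumes "bracket u v = 1"
  shows "w = bracket w v *\<^sub>R u + bracket u w *\<^sub>R v"
proof -
  have "w$1 = w$1 * bracket u v" "w$2 = w$2 * bracket u v"
    using assms by simp_all
  then show ?thesis
    by (simp add: vec_eq_iff forall_2 bracket_components algebra_simps)
qed

lemma bracket_nonzero_iff_independent:
  "bracket u v \<noteq> 0 \<longleftrightarrow> u \<noteq> v \<and> independent {u, v}"
proof (cases "v = 0")
  case True
  then show ?thesis
    using dependent_zero[of "{u, v}"] by (auto simp: bracket.zero_right)
next
  case False
  have "u \<in> span {v} \<longleftrightarrow> bracket u v = 0"
  proof
    assume "u \<in> span {v}"
    then show "bracket u v = 0"
      by (auto simp: span_singleton bracket.scaleR_left)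
  next
    assume 0: "bracket u v = 0"
    have "v$1 \<noteq> 0 \<or> v$2 \<noteq> 0"
      using False by (simp add: vec_eq_iff forall_2)
    then have "\<exists>c. u = c *\<^sub>R v"
    proof
      assume "v$1 \<noteq> 0"
      then have "u = (u$1 / v$1) *\<^sub>R v"
        using 0 by (simp add: vec_eq_iff forall_2 bracket_components field_simps)
      then show ?thesis ..
    next
      assume "v$2 \<noteq> 0"
      then have "u = (u$2 / v$2) *\<^sub>R v"
        using 0 by (simp add: vec_eq_iff forall_2 bracket_components field_simps)
      then show ?thesis ..
    qed
    then show "u \<in> span {v}"
      by (auto simp: span_singleton)
  qed
  moreover have "u \<noteq> v \<and> independent {u, v} \<longleftrightarrow> u \<notin> span {v}"
    using False by (auto simp: independent_insert span_base)
  ultimately show ?thesis by blast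
qed

section \<open>Derivatives of smooth maps\<close>

lemma vd_eqI: "(f has_vector_derivative d) (at s) \<Longrightarrow> vd f s = d"
  unfolding vd_def by (rule vector_derivative_at)

lemma smooth_vd: "smooth f \<Longrightarrow> smooth (vd f)"
  unfolding smooth_def by (metis comp_apply funpow_Suc_right)

lemma smooth_has_vd: "smooth f \<Longrightarrow> (f has_vector_derivative vd f s) (at s)"
  unfolding smooth_def vd_def by (metis funpow_0 vector_derivative_works)

lemma vd_periodic:
  assumes "smooth f" and "\<And>s. f (s + L) = f s"
  shows "vd f (s + L) = vd f s"
proof -
  have "((f \<circ> (\<lambda>s. s + L)) has_vector_derivative 1 *\<^sub>R vd f (s + L)) (at s)"
    by (intro vector_diff_chain_at smooth_has_vd assms) (auto intro!: derivative_eq_intros)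
  moreover have "f \<circ> (\<lambda>s. s + L) = f"
    using assms(2) by auto
  ultimately show ?thesis
    by (simp add: vd_eqI)
qed

section \<open>Singular points of a curve with a tangent field\<close>

text \<open>
  A curve whose velocity stays parallel to a turning field \<open>W\<close> is singular where the scalar speed
  \<open>h\<close> vanishes. At such a point the second derivative sees \<open>W\<close> only, and the third derivative leaves
  the line spanned by \<open>W\<close> through the term \<open>2 h1 W1\<close> alone; so both conditions for an ordinary cusp
  reduce to a simple zero of \<open>h\<close>.
\<close>

lemma vanishing_velocity_cusp:
  fixes X W :: "real \<Rightarrow> real^2" and h :: "real \<Rightarrow> real"
  assumes X: "\<And>s. (X has_vector_derivative h s *\<^sub>R W s) (at s)"
    and h: "\<And>s. (h has_real_derivative h1 s) (at s)"
    and h1: "\<And>s. (h1 has_real_derivative h2 s) (at s)"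
    and W: "\<And>s. (W has_vector_derivative W1 s) (at s)"
    and W1: "\<And>s. (W1 has_vector_derivative W2 s) (at s)"
    and frame: "bracket (W s\<^sub>0) (W1 s\<^sub>0) \<noteq> 0"
  shows "affine_cusp X s\<^sub>0 \<longleftrightarrow> h s\<^sub>0 = 0"
    and "affine_cusp X s\<^sub>0 \<Longrightarrow> ordinary_affine_cusp X s\<^sub>0 \<longleftrightarrow> h1 s\<^sub>0 \<noteq> 0"
proof -
  have "W s\<^sub>0 \<noteq> 0"
    using frame by (auto simp: bracket.zero_left)
  have vdX: "vd X = (\<lambda>s. h s *\<^sub>R W s)"
    by (rule ext, rule vd_eqI, rule X)
  show cusp: "affine_cusp X s\<^sub>0 \<longleftrightarrow> h s\<^sub>0 = 0"
    using \<open>W s\<^sub>0 \<noteq> 0\<close> by (simp add: affine_cusp_def vdX)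
  have vd2X: "vd (vd X) = (\<lambda>s. h s *\<^sub>R W1 s + h1 s *\<^sub>R W s)"
    unfolding vdX by (rule ext, rule vd_eqI, rule has_vector_derivative_scaleR[OF h W])
  have vd3X: "vd (vd (vd X)) = (\<lambda>s. (h s *\<^sub>R W2 s + h1 s *\<^sub>R W1 s) + (h1 s *\<^sub>R W1 s + h2 s *\<^sub>R W s))"
    unfolding vd2X
    by (rule ext, rule vd_eqI, intro has_vector_derivative_add has_vector_derivative_scaleR h h1 W W1)
  assume c: "affine_cusp X s\<^sub>0"
  then have "h s\<^sub>0 = 0"
    using cusp by simp
  then have "bracket (vd (vd X) s\<^sub>0) (vd (vd (vd X)) s\<^sub>0)
      = 2 * (h1 s\<^sub>0)\<^sup>2 * bracket (W s\<^sub>0) (W1 s\<^sub>0)"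
    unfolding vd3X unfolding vd2X
    by (simp add: bracket_components power2_eq_square algebra_simps)
  then have "bracket (vd (vd X) s\<^sub>0) (vd (vd (vd X)) s\<^sub>0) \<noteq> 0 \<longleftrightarrow> h1 s\<^sub>0 \<noteq> 0"
    using frame by simp
  then show "ordinary_affine_cusp X s\<^sub>0 \<longleftrightarrow> h1 s\<^sub>0 \<noteq> 0"
    using c by (simp add: ordinary_affine_cusp_def bracket_nonzero_iff_independent)
qed

section \<open>Affine curvature\<close>

text \<open>
  Differentiating \<open>[\<gamma>\<^sub>s, \<gamma>\<^sub>s\<^sub>s] = 1\<close> removes the \<open>\<gamma>\<^sub>s\<^sub>s\<close> component of the third derivative.
\<close>

lemma vd3_eq_affine_curvature:
  assumes "smooth \<gamma>" and "affine_arclength_param \<gamma>"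
  shows "vd (vd (vd \<gamma>)) s = - affine_curvature \<gamma> s *\<^sub>R vd \<gamma> s"
proof -
  note D = smooth_has_vd[OF smooth_vd, OF assms(1)]
    smooth_has_vd[OF smooth_vd, OF smooth_vd, OF assms(1)]
  have unit: "bracket (vd \<gamma> t) (vd (vd \<gamma>) t) = 1" for t
    using assms(2) by (simp add: affine_arclength_param_def)
  have "((\<lambda>t. bracket (vd \<gamma> t) (vd (vd \<gamma>) t)) has_vector_derivative
      bracket (vd \<gamma> s) (vd (vd (vd \<gamma>)) s) + bracket (vd (vd \<gamma>) s) (vd (vd \<gamma>) s)) (at s)"
    by (intro bracket.has_vector_derivative D)
  then have "((\<lambda>t. 1) has_vector_derivative bracket (vd \<gamma> s) (vd (vd (vd \<gamma>)) s)) (at s)"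
    by (simp add: unit)
  then have "bracket (vd \<gamma> s) (vd (vd (vd \<gamma>)) s) = 0"
    using has_vector_derivative_const vector_derivative_at by metis
  then show ?thesis
    using expand_in_unimodular_frame[OF unit, of "vd (vd (vd \<gamma>)) s" s]
      bracket_swap[of "vd (vd (vd \<gamma>)) s" "vd (vd \<gamma>) s"]
    by (simp add: affine_curvature_def)
qed

text \<open>
  Three derivatives are what the third derivative of the envelope consumes: its speed already
  involves \<open>\<mu>\<^sub>s\<close>.
\<close>

lemma affine_curvature_thrice_differentiable:
  assumes "smooth \<gamma>"
  shows "(affine_curvature \<gamma> has_real_derivative vd (affine_curvature \<gamma>) s) (at s)"
    and "(vd (affine_curvature \<gamma>) has_real_derivative vd (vd (affine_curvature \<gamma>)) s) (at s)"
    and "(vd (vd (affine_curvature \<gamma>)) has_real_derivative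
            vd (vd (vd (affine_curvature \<gamma>))) s) (at s)"
proof -
  define g where "g k = (vd ^^ k) \<gamma>" for k
  have g: "(g k has_vector_derivative g (Suc k) s) (at s)" for k s
    using assms unfolding g_def smooth_def by (simp add: vd_def vector_derivative_works)
  note D = bracket.has_vector_derivative[OF g g]
  have 0: "affine_curvature \<gamma> = (\<lambda>s. bracket (g 2 s) (g 3 s))"
    by (simp add: fun_eq_iff affine_curvature_def g_def numeral_eq_Suc)
  \<comment> \<open>the other product-rule term is \<open>[\<gamma>\<^sub>s\<^sub>s\<^sub>s, \<gamma>\<^sub>s\<^sub>s\<^sub>s] = 0\<close>\<close>
  have d0: "(affine_curvature \<gamma> has_vector_derivative bracket (g 2 s) (g 4 s)) (at s)" for s
    using D[of 2 3 s] by (simp add: 0)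
  have 1: "vd (affine_curvature \<gamma>) = (\<lambda>s. bracket (g 2 s) (g 4 s))"
    by (rule ext, rule vd_eqI, rule d0)
  have d1: "(vd (affine_curvature \<gamma>) has_vector_derivative
      bracket (g 2 s) (g 5 s) + bracket (g 3 s) (g 4 s)) (at s)" for s
    using D[of 2 4 s] by (simp add: 1)
  have 2: "vd (vd (affine_curvature \<gamma>)) = (\<lambda>s. bracket (g 2 s) (g 5 s) + bracket (g 3 s) (g 4 s))"
    by (rule ext, rule vd_eqI, rule d1)
  have d2: "(vd (vd (affine_curvature \<gamma>)) has_vector_derivative
      (bracket (g 2 s) (g (Suc 5) s) + bracket (g (Suc 2) s) (g 5 s))
      + (bracket (g 3 s) (g (Suc 4) s) + bracket (g (Suc 3) s) (g 4 s))) (at s)" for s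
    unfolding 2 by (intro has_vector_derivative_add D)
  show "(affine_curvature \<gamma> has_real_derivative vd (affine_curvature \<gamma>) s) (at s)"
    "(vd (affine_curvature \<gamma>) has_real_derivative vd (vd (affine_curvature \<gamma>)) s) (at s)"
    "(vd (vd (affine_curvature \<gamma>)) has_real_derivative vd (vd (vd (affine_curvature \<gamma>))) s) (at s)"
    using d0 d1 d2 vd_eqI[OF d0] vd_eqI[OF d1] vd_eqI[OF d2]
    unfolding has_real_derivative_iff_has_vector_derivative by metis+
qed

text \<open>
  Having no zero, \<open>\<mu>\<close> has constant sign. If it were negative, \<open>\<gamma>\<^sub>s\<^sub>s\<^sub>s = - \<mu> \<gamma>\<^sub>s\<close> would push \<open>\<gamma>\<^sub>s\<close> away
  from the origin: \<open>\<bar>\<gamma>\<^sub>s\<bar>\<^sup>2\<close> would be strictly convex, which no periodic function is.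
\<close>

lemma closed_curve_affine_curvature_pos:
  assumes "closed_curve \<gamma>" and "affine_arclength_param \<gamma>"
    and "\<forall>s. \<not> affine_inflexion \<gamma> s"
  shows "0 < affine_curvature \<gamma> s"
proof (rule ccontr)
  let ?\<mu> = "affine_curvature \<gamma>" and ?T = "vd \<gamma>" and ?N = "vd (vd \<gamma>)"
  from assms(1) obtain L where sm: "smooth \<gamma>" and "L > 0" and per: "\<And>s. \<gamma> (s + L) = \<gamma> s"
    by (auto simp: closed_curve_def)
  have nz: "?\<mu> t \<noteq> 0" for t
    using assms(3) by (simp add: affine_inflexion_def)
  assume "\<not> 0 < ?\<mu> s"
  have neg: "?\<mu> t < 0" for t
  proof (rule ccontr)
    assume "\<not> ?\<mu> t < 0"
    moreover have "connected (range ?\<mu>)"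
      by (meson connected_continuous_image connected_UNIV continuous_at_imp_continuous_on
          DERIV_isCont affine_curvature_thrice_differentiable(1)[OF sm])
    ultimately have "0 \<in> range ?\<mu>"
      using \<open>\<not> 0 < ?\<mu> s\<close> unfolding connected_iff_interval
      by (metis linorder_le_less_linear not_less rangeI)
    then show False
      using nz by auto
  qed
  \<comment> \<open>half the derivative of \<open>\<bar>\<gamma>\<^sub>s\<bar>\<^sup>2\<close>: strictly increasing and periodic\<close>
  define g where "g t = ?T t \<bullet> ?N t" for t
  have g': "(g has_real_derivative (?N t \<bullet> ?N t - ?\<mu> t * (?T t \<bullet> ?T t))) (at t)" for t
  proof -
    have "(g has_vector_derivative ?T t \<bullet> vd ?N t + ?N t \<bullet> ?N t) (at t)"
      unfolding g_def
      by (intro bounded_bilinear.has_vector_derivative[OF bounded_bilinear_inner]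
          smooth_has_vd smooth_vd sm)
    then show ?thesis
      by (simp add: has_real_derivative_iff_has_vector_derivative
          vd3_eq_affine_curvature[OF sm assms(2)])
  qed
  have "?T (0 + L) = ?T 0" "?N (0 + L) = ?N 0"
    by (intro vd_periodic smooth_vd sm per)+
  then have "g L = g 0"
    by (simp add: g_def)
  then obtain z where z: "?N z \<bullet> ?N z - ?\<mu> z * (?T z \<bullet> ?T z) = 0"
    using MVT2[OF \<open>L > 0\<close> g'] \<open>L > 0\<close> by auto
  have "?T z \<noteq> 0"
    using assms(2) by (metis affine_arclength_param_def bracket.zero_left zero_neq_one)
  then have "0 < - ?\<mu> z * (?T z \<bullet> ?T z)"
    using neg[of z] by (intro mult_pos_pos) auto
  then show False
    using z inner_ge_zero[of "?N z"] by linarith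
qed

section \<open>The envelope\<close>

theorem proposition4:
  fixes \<gamma> X :: "real \<Rightarrow> real^2" and \<mu> :: "real \<Rightarrow> real" and \<alpha> s\<^sub>0 :: real
  assumes "closed_curve \<gamma>"
    and "affine_arclength_param \<gamma>"
    and "\<mu> = affine_curvature \<gamma>"
    and "\<forall>s. \<not> affine_inflexion \<gamma> s"
    and "0 < \<alpha>" and "\<alpha> < 1"
    and "X = (\<lambda>s. \<gamma> s + (\<alpha> / ((1 - \<alpha>)^2 + \<mu> s * \<alpha>^2)) *\<^sub>R
                     ((1 - \<alpha>) *\<^sub>R vd \<gamma> s + \<alpha> *\<^sub>R vd (vd \<gamma>) s))"
  shows "(affine_cusp X s\<^sub>0 \<longleftrightarrow>
            vd \<mu> s\<^sub>0 = (1 - \<alpha>) * ((1 - \<alpha>)^2 + \<mu> s\<^sub>0 * \<alpha>^2) / \<alpha>^3) \<and>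
         (affine_cusp X s\<^sub>0 \<longrightarrow>
            (ordinary_affine_cusp X s\<^sub>0 \<longleftrightarrow> \<alpha> * vd (vd \<mu>) s\<^sub>0 \<noteq> (1 - \<alpha>) * vd \<mu> s\<^sub>0))"
proof -
  define \<beta> where "\<beta> = 1 - \<alpha>"
  define D where "D s = \<beta>\<^sup>2 + \<mu> s * \<alpha>\<^sup>2" for s
  define W where "W s = \<beta> *\<^sub>R vd \<gamma> s + \<alpha> *\<^sub>R vd (vd \<gamma>) s" for s
  define W1 where "W1 s = \<beta> *\<^sub>R vd (vd \<gamma>) s + \<alpha> *\<^sub>R vd (vd (vd \<gamma>)) s" for s
  define W2 where "W2 s = \<beta> *\<^sub>R vd (vd (vd \<gamma>)) s + \<alpha> *\<^sub>R vd (vd (vd (vd \<gamma>))) s" for s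
  \<comment> \<open>the speed is kept as a product \<open>p q\<close>: at a zero of \<open>p\<close> the derivative of \<open>q\<close> drops out\<close>
  define p where "p s = \<beta> * D s - \<alpha>^3 * vd \<mu> s" for s
  define p1 where "p1 s = \<beta> * (\<alpha>\<^sup>2 * vd \<mu> s) - \<alpha>^3 * vd (vd \<mu>) s" for s
  define p2 where "p2 s = \<beta> * (\<alpha>\<^sup>2 * vd (vd \<mu>) s) - \<alpha>^3 * vd (vd (vd \<mu>)) s" for s
  define q where "q s = 1 / (D s)\<^sup>2" for s
  define q1 where "q1 s = - 2 * \<alpha>\<^sup>2 * vd \<mu> s / D s ^ 3" for s
  define q2 where "q2 s = - 2 * \<alpha>\<^sup>2 * vd (vd \<mu>) s / D s ^ 3 + 6 * (\<alpha>\<^sup>2 * vd \<mu> s)\<^sup>2 / D s ^ 4" for s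
  have sm: "smooth \<gamma>"
    using assms(1) by (simp add: closed_curve_def)
  have unit: "bracket (vd \<gamma> s) (vd (vd \<gamma>) s) = 1" for s
    using assms(2) by (simp add: affine_arclength_param_def)
  have frenet: "vd (vd (vd \<gamma>)) s = - \<mu> s *\<^sub>R vd \<gamma> s" for s
    unfolding \<open>\<mu> = affine_curvature \<gamma>\<close> by (rule vd3_eq_affine_curvature[OF sm assms(2)])
  have "0 < \<mu> s" for s
    unfolding \<open>\<mu> = affine_curvature \<gamma>\<close>
    by (rule closed_curve_affine_curvature_pos[OF assms(1,2,4)])
  then have D_pos: "0 < D s" for s
    unfolding D_def using assms(5) by (intro add_nonneg_pos mult_pos_pos) auto
  then have D_nz: "D s \<noteq> 0" for s
    by (metis less_irrefl)
  note \<mu>' = affine_curvature_thrice_differentiable[OF sm, folded \<open>\<mu> = affine_curvature \<gamma>\<close>]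
  note \<gamma>' = smooth_has_vd[OF sm] smooth_has_vd[OF smooth_vd, OF sm]
    smooth_has_vd[OF smooth_vd, OF smooth_vd, OF sm]
    smooth_has_vd[OF smooth_vd, OF smooth_vd, OF smooth_vd, OF sm]
  have D': "(D has_real_derivative \<alpha>\<^sup>2 * vd \<mu> s) (at s)" for s
    unfolding D_def by (auto intro!: derivative_eq_intros \<mu>')
  have p': "(p has_real_derivative p1 s) (at s)"
    and p1': "(p1 has_real_derivative p2 s) (at s)" for s
    unfolding p_def p1_def p2_def by (auto intro!: derivative_eq_intros \<mu>' D')
  have q': "(q has_real_derivative q1 s) (at s)" for s
    unfolding q_def q1_def using D_nz[of s]
    by (auto intro!: derivative_eq_intros D' simp: field_simps power2_eq_square power3_eq_cube)
  have q1': "(q1 has_real_derivative q2 s) (at s)" for s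
    unfolding q1_def q2_def using D_nz[of s]
    by (auto intro!: derivative_eq_intros \<mu>' D' simp: field_simps power2_eq_square eval_nat_numeral)
  have W': "(W has_vector_derivative W1 s) (at s)"
    and W1': "(W1 has_vector_derivative W2 s) (at s)" for s
    unfolding W_def W1_def W2_def
    by (auto intro!: derivative_eq_intros \<gamma>')
  have X': "(X has_vector_derivative (p s * q s) *\<^sub>R W s) (at s)" for s
  proof -
    have "((\<lambda>s. \<alpha> / D s) has_real_derivative (- (\<alpha>^3) * vd \<mu> s / (D s)\<^sup>2)) (at s)"
      using D_nz[of s]
      by (auto intro!: derivative_eq_intros D' simp: field_simps power2_eq_square power3_eq_cube)
    then have "((\<lambda>s. \<gamma> s + (\<alpha> / D s) *\<^sub>R W s) has_vector_derivative
        vd \<gamma> s + ((\<alpha> / D s) *\<^sub>R W1 s + (- (\<alpha>^3) * vd \<mu> s / (D s)\<^sup>2) *\<^sub>R W s)) (at s)"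
      by (intro has_vector_derivative_add has_vector_derivative_scaleR \<gamma>' W')
    moreover have "vd \<gamma> s + (\<alpha> / D s) *\<^sub>R W1 s = (\<beta> / D s) *\<^sub>R W s"
    proof -
      have "D s *\<^sub>R vd \<gamma> s + \<alpha> *\<^sub>R W1 s = \<beta> *\<^sub>R W s"
        by (simp add: D_def W1_def W_def frenet algebra_simps power2_eq_square)
      then have "(1 / D s) *\<^sub>R (D s *\<^sub>R vd \<gamma> s + \<alpha> *\<^sub>R W1 s) = (1 / D s) *\<^sub>R (\<beta> *\<^sub>R W s)"
        by (rule arg_cong)
      then show ?thesis
        using D_nz[of s] by (simp add: scaleR_add_right)
    qed
    moreover have "X = (\<lambda>s. \<gamma> s + (\<alpha> / D s) *\<^sub>R W s)"
      unfolding assms(7) D_def W_def \<beta>_def ..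
    moreover have "p s * q s = \<beta> / D s + (- (\<alpha>^3) * vd \<mu> s / (D s)\<^sup>2)"
      using D_nz[of s] by (simp add: p_def q_def field_simps power2_eq_square)
    ultimately show ?thesis
      by (simp only: scaleR_add_left add.assoc[symmetric])
  qed
  have h': "((\<lambda>s. p s * q s) has_real_derivative p1 s * q s + q1 s * p s) (at s)" for s
    by (rule DERIV_mult[OF p' q'])
  have h1': "((\<lambda>s. p1 s * q s + q1 s * p s) has_real_derivative
      (p2 s * q s + q1 s * p1 s) + (q2 s * p s + p1 s * q1 s)) (at s)" for s
    by (intro DERIV_add DERIV_mult p' p1' q' q1')
  have "bracket (W s) (W1 s) = D s" for s
    using unit[of s] bracket_swap[of "vd (vd \<gamma>) s" "vd \<gamma> s"]
    by (simp add: W_def W1_def D_def frenet bracket.add_left bracket.add_right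
        bracket.scaleR_left bracket.scaleR_right bracket.diff_right power2_eq_square)
  then have frame: "bracket (W s\<^sub>0) (W1 s\<^sub>0) \<noteq> 0"
    using D_nz by simp
  note cusp = vanishing_velocity_cusp[OF X' h' h1' W' W1' frame]
  have q_nz: "q s\<^sub>0 \<noteq> 0"
    using D_nz by (simp add: q_def)
  have "affine_cusp X s\<^sub>0 \<longleftrightarrow> p s\<^sub>0 = 0"
    using cusp(1) q_nz by simp
  moreover have "p s\<^sub>0 = 0 \<longleftrightarrow> vd \<mu> s\<^sub>0 = \<beta> * D s\<^sub>0 / \<alpha>^3"
    using assms(5) by (auto simp: p_def field_simps)
  moreover have "ordinary_affine_cusp X s\<^sub>0 \<longleftrightarrow> p1 s\<^sub>0 \<noteq> 0" if "affine_cusp X s\<^sub>0"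
    using cusp(2)[OF that] q_nz calculation(1) that by simp
  moreover have "p1 s\<^sub>0 = \<alpha>\<^sup>2 * (\<beta> * vd \<mu> s\<^sub>0 - \<alpha> * vd (vd \<mu>) s\<^sub>0)"
    by (simp add: p1_def algebra_simps power2_eq_square power3_eq_cube)
  ultimately show ?thesis
    using assms(5) by (auto simp: D_def \<beta>_def)
qed

end
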